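(* Let $N\ge 2$, $d\ge 1$, let $\psi,\mathcal{V}$ satisfy the standing assumptions stated in the context, and let $X:=\mathbb{R}^{Nd}\times\mathbb{R}^{Nd}$. A function $C:X\to\mathbb{R}$ that is partially differentiable is a Casimir function for the port-Hamiltonian system $$\frac{\mathrm{d}}{\mathrm{d}t}z=\left[\begin{pmatrix}0&I\\-I&0\end{pmatrix}-\begin{pmatrix}0&0\\0&\Psi(z)\end{pmatrix}\right]\frac{\partial\mathcal{H}^N(z)}{\partial z}$$ if and only if there is some $\gamma\in\mathbb{R}$ such that $C(r,v)=\gamma$ for all $(r,v)\in X$.
   Context: States are $z=(r,v)=(r_1,\dots,r_N,v_1,\dots,v_N)\in X$ with $r_i,v_i\in\mathbb{R}^d$. "Partially differentiable" means that all first-order partial derivatives exist at every point of $X$. A partially differentiable $C:X\to\mathbb{R}$ is called a Casimir function for the system above if $$\Big(\frac{\partial C}{\partial z}(z)\Big)^\top\left[\begin{pmatrix}0&I\\-I&0\end{pmatrix}-\begin{pmatrix}0&0\\0&\Psi(z)\end{pmatrix}\right]=0\quad\text{for all }z\in X.$$ Here $\Psi(z)$ is the symmetric $N\times N$ block matrix (each scalar entry multiplying the $d\times d$ identity) with off-diagonal entries $\Psi(z)_{ij}=-\frac1N\psi(|r_j-r_i|)$, $i\ne j$, and diagonal entries $\Psi(z)_{ii}=\frac1N\sum_{j\ne i}\psi(|r_j-r_i|)$. The Hamiltonian is $\mathcal{H}^N(z)=\frac12\sum_{i=1}^N\big(|v_i-\bar v|^2+\frac1N\sum_{j=1}^N\mathcal{V}(r_i-r_j)\big)$,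 with $\bar v$ the (conserved) mean velocity. Standing assumptions: $\psi:\mathbb{R}\to\mathbb{R}_{\ge 0}$; $\mathcal{V}:\mathbb{R}^d\to\mathbb{R}$ is continuously differentiable with $\nabla\mathcal{V}(-x)=-\nabla\mathcal{V}(x)$; and the functions $F_i(t,x,v)=\frac1N\sum_{j}\psi(|x_j-x_i|)(v_j-v_i)-\frac1N\sum_{j}\nabla\mathcal{V}(x_i-x_j)$, $i=1,\dots,N$, are continuous, satisfy $|F_i(t,x,v)|\le C_0(1+|x|+|v|)$ for some constant $C_0>0$, and are Lipschitz in $(x,v)$ on every compact subset of $\mathbb{R}^{dN}\times\mathbb{R}^{dN}$. *)

theory Defs
  imports "HOL-Analysis.Analysis"
begin

section \<open>Partial derivatives\<close>

definition has_partials :: "('a::euclidean_space \<Rightarrow> real) \<Rightarrow> bool" where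
  "has_partials f \<longleftrightarrow>
     (\<forall>x. \<forall>b\<in>Basis. (\<lambda>t::real. f (x + t *\<^sub>R b)) differentiable (at 0))"

definition partial :: "('a::euclidean_space \<Rightarrow> real) \<Rightarrow> 'a \<Rightarrow> 'a \<Rightarrow> real" where
  "partial f b x = deriv (\<lambda>t::real. f (x + t *\<^sub>R b)) 0"

definition gradient :: "('a::euclidean_space \<Rightarrow> real) \<Rightarrow> 'a \<Rightarrow> 'a" where
  "gradient f x = (\<Sum>b\<in>Basis. partial f b x *\<^sub>R b)"


section \<open>States and block matrices\<close>

text \<open>
  There are \<open>N = CARD('n)\<close> particles in dimension \<open>d = CARD('d)\<close>. A state is \<open>z = (r, v)\<close>,
  with \<open>r $ i\<close> and \<open>v $ i\<close> the position and velocity of particle \<open>i\<close>. The scalar coordinates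
  of a state, and hence the rows and columns of the system matrices, are indexed by
  \<open>('n, 'd) coord\<close>: \<open>Inl (i, k)\<close> is component \<open>k\<close> of \<open>r $ i\<close>, and \<open>Inr (i, k)\<close> is component
  \<open>k\<close> of \<open>v $ i\<close>.
\<close>

type_synonym ('n, 'd) state = "(real ^ 'd ^ 'n) \<times> (real ^ 'd ^ 'n)"
type_synonym ('n, 'd) coord = "('n \<times> 'd) + ('n \<times> 'd)"

definition unit_state :: "('n::finite, 'd::finite) coord \<Rightarrow> ('n, 'd) state" where
  "unit_state c = (case c of
      Inl (i, k) \<Rightarrow> (axis i (axis k 1), 0)
    | Inr (i, k) \<Rightarrow> (0, axis i (axis k 1)))"

definition partial_z ::
    "(('n::finite, 'd::finite) state \<Rightarrow> real) \<Rightarrow> ('n, 'd) state \<Rightarrow> real ^ ('n, 'd) coord" where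
  "partial_z f z = (\<chi> c. partial f (unit_state c) z)"

definition block_matrix ::
    "real ^ 'p ^ 'p \<Rightarrow> real ^ 'p ^ 'p \<Rightarrow> real ^ 'p ^ 'p \<Rightarrow> real ^ 'p ^ 'p
      \<Rightarrow> real ^ ('p::finite + 'p) ^ ('p + 'p)" where
  "block_matrix A B C D = (\<chi> a b. case a of
      Inl p \<Rightarrow> (case b of Inl q \<Rightarrow> A $ p $ q | Inr q \<Rightarrow> B $ p $ q)
    | Inr p \<Rightarrow> (case b of Inl q \<Rightarrow> C $ p $ q | Inr q \<Rightarrow> D $ p $ q))"


section \<open>Port-Hamiltonian systems and Casimir functions\<close>

text \<open>
  The record stands for the system \<open>dz/dt = (J - R z) \<partial>H(z)/\<partial>z\<close>. The condition on a Casimir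
  function involves only the matrix \<open>J - R z\<close>, not the Hamiltonian.
\<close>

record ('n, 'd) port_hamiltonian =
  interconnection :: "real ^ ('n, 'd) coord ^ ('n, 'd) coord"
  dissipation :: "('n, 'd) state \<Rightarrow> real ^ ('n, 'd) coord ^ ('n, 'd) coord"
  hamiltonian :: "('n, 'd) state \<Rightarrow> real"

definition casimir ::
    "('n::finite, 'd::finite) port_hamiltonian \<Rightarrow> (('n, 'd) state \<Rightarrow> real) \<Rightarrow> bool" where
  "casimir S C \<longleftrightarrow> has_partials C \<and>
     (\<forall>z. partial_z C z v* (interconnection S - dissipation S z) = 0)"


section \<open>The interacting particle system\<close>

definition Psi_entry ::
    "(real \<Rightarrow> real) \<Rightarrow> ('n::finite, 'd::finite) state \<Rightarrow> 'n \<Rightarrow> 'n \<Rightarrow> real" where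
  "Psi_entry \<psi> z i j =
     (if i \<noteq> j then - (1 / real CARD('n)) * \<psi> (norm (fst z $ j - fst z $ i))
      else (1 / real CARD('n)) * (\<Sum>l\<in>UNIV - {i}. \<psi> (norm (fst z $ l - fst z $ i))))"

text \<open>Each scalar entry multiplies the \<open>d \<times> d\<close> identity matrix.\<close>

definition Psi ::
    "(real \<Rightarrow> real) \<Rightarrow> ('n::finite, 'd::finite) state \<Rightarrow> real ^ ('n \<times> 'd) ^ ('n \<times> 'd)" where
  "Psi \<psi> z = (\<chi> a b. if snd a = snd b then Psi_entry \<psi> z (fst a) (fst b) else 0)"

definition mean_velocity :: "real ^ 'd ^ 'n \<Rightarrow> real ^ 'd" where
  "mean_velocity v = (1 / real CARD('n)) *\<^sub>R (\<Sum>i\<in>UNIV. v $ i)"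

definition energy :: "(real ^ 'd \<Rightarrow> real) \<Rightarrow> ('n::finite, 'd::finite) state \<Rightarrow> real" where
  "energy V z = 1 / 2 * (\<Sum>i\<in>UNIV. (norm (snd z $ i - mean_velocity (snd z)))\<^sup>2
     + 1 / real CARD('n) * (\<Sum>j\<in>UNIV. V (fst z $ i - fst z $ j)))"

definition particle_system ::
    "(real \<Rightarrow> real) \<Rightarrow> (real ^ 'd \<Rightarrow> real) \<Rightarrow> ('n::finite, 'd::finite) port_hamiltonian" where
  "particle_system \<psi> V = \<lparr>
     interconnection = block_matrix 0 (mat 1) (- mat 1) 0,
     dissipation = (\<lambda>z. block_matrix 0 0 0 (Psi \<psi> z)),
     hamiltonian = energy V \<rparr>"

definition force ::
    "(real \<Rightarrow> real) \<Rightarrow> (real ^ 'd \<Rightarrow> real) \<Rightarrow> 'n::finite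
      \<Rightarrow> real \<Rightarrow> real ^ 'd ^ 'n \<Rightarrow> real ^ 'd ^ 'n \<Rightarrow> real ^ 'd::finite" where
  "force \<psi> V i t x v =
     (1 / real CARD('n)) *\<^sub>R (\<Sum>j\<in>UNIV. \<psi> (norm (x $ j - x $ i)) *\<^sub>R (v $ j - v $ i))
     - (1 / real CARD('n)) *\<^sub>R (\<Sum>j\<in>UNIV. gradient V (x $ i - x $ j))"

text \<open>
  The type token only fixes the index type \<open>'n\<close> of the particles, that is, the number \<open>N\<close>.
\<close>

definition standing_assumptions ::
    "'n::finite itself \<Rightarrow> (real \<Rightarrow> real) \<Rightarrow> (real ^ 'd::finite \<Rightarrow> real) \<Rightarrow> bool" where
  "standing_assumptions _ \<psi> V \<longleftrightarrow>
     (\<forall>s. 0 \<le> \<psi> s) \<and>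
     (\<forall>x. V differentiable (at x)) \<and> continuous_on UNIV (gradient V) \<and>
     (\<forall>x. gradient V (- x) = - gradient V x) \<and>
     (\<forall>i::'n. continuous_on UNIV (\<lambda>(t, x, v). force \<psi> V i t x v)) \<and>
     (\<exists>C\<^sub>0>0. \<forall>(i::'n) t x v. norm (force \<psi> V i t x v) \<le> C\<^sub>0 * (1 + norm x + norm v)) \<and>
     (\<forall>(i::'n) K. compact K \<longrightarrow>
        (\<exists>L. \<forall>t. L-lipschitz_on K (\<lambda>(x, v). force \<psi> V i t x v)))"

end

theory Submission
  imports Defs
begin

text \<open>
  The matrix of the system has the block form with rows \<open>(0, I)\<close> and \<open>(-I, -\<Psi>)\<close>, which is
  invertible whatever \<open>\<Psi>\<close> is. Hence all partial derivatives of a Casimir function vanish, and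
  moving along one coordinate at a time shows that it is constant.
\<close>

text \<open>On the line through \<open>x\<close> in direction \<open>b\<close>, \<open>f\<close>
  becomes a function of one real variable, and its derivative at each parameter is a partial
  derivative of \<open>f\<close> at the corresponding point of the line. This is why
  \<open>zero\<close> ranges over all points.\<close>

lemma has_partials_const_along_Basis:
  assumes "has_partials f" and zero: "\<And>x. partial f b x = 0" and b: "b \<in> Basis"
  shows "f (x + t *\<^sub>R b) = f x"
proof -
  define g where "g = (\<lambda>s. f (x + s *\<^sub>R b))"
  have "(g has_real_derivative 0) (at s)" for s
  proof -
    have "(\<lambda>u. f ((x + s *\<^sub>R b) + u *\<^sub>R b)) field_differentiable (at 0)"
      using assms(1) b unfolding has_partials_def
      by (metis differentiable_def has_field_derivative_def has_real_derivative
          field_differentiable_def)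
    then have "((\<lambda>u. f ((x + s *\<^sub>R b) + u *\<^sub>R b)) has_real_derivative 0) (at 0)"
      using zero[of "x + s *\<^sub>R b"] by (simp add: partial_def flip: DERIV_deriv_iff_field_differentiable)
    \<comment> \<open>\<open>partial\<close> differentiates only at parameter 0, so the derivative
      of \<open>g\<close> at \<open>s\<close> is computed from the base point moved by
      \<open>s\<close> along \<open>b\<close> and then shifted back.\<close>
    then have "((\<lambda>u. g (u + s)) has_real_derivative 0) (at 0)"
      by (simp add: g_def algebra_simps)
    then show ?thesis
      using DERIV_shift[of g 0 0 s] by simp
  qed
  then have "g t = g 0"
    by (intro DERIV_isconst_all) auto
  then show ?thesis
    by (simp add: g_def)
qed

lemma constant_iff_partials_zero:
  fixes f :: "'a::euclidean_space \<Rightarrow> real"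
  assumes "has_partials f"
  shows "(\<forall>x. \<forall>b\<in>Basis. partial f b x = 0) \<longleftrightarrow> (\<exists>\<gamma>. \<forall>x. f x = \<gamma>)"
proof
  assume zero: "\<forall>x. \<forall>b\<in>Basis. partial f b x = 0"
  \<comment> \<open>The partial sums of a basis expansion are the corners of such a path; each
    induction step walks one edge.\<close>
  have "f (\<Sum>b\<in>S. c b *\<^sub>R b) = f 0" if "finite S" "S \<subseteq> Basis" for S c
    using that
  proof (induction S rule: finite_induct)
    case (insert b S)
    then have "f ((\<Sum>b\<in>S. c b *\<^sub>R b) + c b *\<^sub>R b) = f (\<Sum>b\<in>S. c b *\<^sub>R b)"
      using has_partials_const_along_Basis[OF assms, of b] zero by auto
    with insert show ?case
      by (simp add: add.commute)
  qed simp
  from this[OF finite_Basis order_refl, of "\<lambda>b. x \<bullet> b" for x]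
  show "\<exists>\<gamma>. \<forall>x. f x = \<gamma>"
    by (auto simp: euclidean_representation)
next
  assume "\<exists>\<gamma>. \<forall>x. f x = \<gamma>"
  then obtain \<gamma> where "f = (\<lambda>_. \<gamma>)"
    by blast
  then show "\<forall>x. \<forall>b\<in>Basis. partial f b x = 0"
    by (simp add: partial_def)
qed

text \<open>This links the scalar coordinates that index \<open>partial_z\<close> and the system
  matrices to the \<open>Basis\<close> used for partial derivatives.\<close>

lemma range_unit_state: "range unit_state = Basis"
proof -
  have "z \<in> range unit_state \<longleftrightarrow> z \<in> Basis" for z :: "('n::finite, 'd::finite) state"
  proof
    assume "z \<in> range unit_state"
    then obtain c where "z = unit_state c"
      by blast
    then show "z \<in> Basis"
      by (cases c) (auto simp: unit_state_def Basis_prod_def Basis_vec_def image_iff)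
  next
    assume "z \<in> Basis"
    then obtain i k where "z = (axis i (axis k 1), 0) \<or> z = (0, axis i (axis k 1))"
      by (auto simp: Basis_prod_def Basis_vec_def)
    then have "z = unit_state (Inl (i, k)) \<or> z = unit_state (Inr (i, k))"
      by (simp add: unit_state_def)
    then show "z \<in> range unit_state"
      by blast
  qed
  then show ?thesis
    by blast
qed

lemma partial_z_eq_0_iff: "partial_z f z = 0 \<longleftrightarrow> (\<forall>b\<in>Basis. partial f b z = 0)"
  by (simp add: partial_z_def vec_eq_iff flip: range_unit_state)

lemma sum_sum_UNIV:
  fixes f :: "'a::finite + 'b::finite \<Rightarrow> 'c::comm_monoid_add"
  shows "(\<Sum>c\<in>UNIV. f c) = (\<Sum>a\<in>UNIV. f (Inl a)) + (\<Sum>b\<in>UNIV. f (Inr b))"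
  by (simp add: UNIV_Plus_UNIV[symmetric] sum.Plus del: UNIV_Plus_UNIV)

text \<open>A row vector with blocks (a, b) is sent to (-b, a - b D). The first block forces b = 0,
  and then the second is just a, whatever D is.\<close>

lemma vector_matrix_mult_block_eq_0_iff:
  fixes p :: "real ^ ('p::finite + 'p)"
  shows "p v* (block_matrix 0 (mat 1) (- mat 1) 0 - block_matrix 0 0 0 D) = 0 \<longleftrightarrow> p = 0"
proof
  let ?M = "block_matrix 0 (mat 1) (- mat 1) 0 - block_matrix 0 0 0 D"
  assume "p v* ?M = 0"
  then have zero: "(p v* ?M) $ c = 0" for c
    by simp
  have Inl: "(p v* ?M) $ Inl q = - p $ Inr q" for q
    by (simp add: vector_matrix_mult_def block_matrix_def sum_sum_UNIV mat_def
        if_distrib if_distribR sum_negf cong: if_cong)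
  have Inr: "(p v* ?M) $ Inr q = p $ Inl q - (\<Sum>a\<in>UNIV. p $ Inr a * D $ a $ q)" for q
    by (simp add: vector_matrix_mult_def block_matrix_def sum_sum_UNIV mat_def
        if_distrib if_distribR sum_negf cong: if_cong)
  have "p $ Inr q = 0" for q
    using zero Inl by (metis neg_equal_0_iff_equal)
  moreover from this have "p $ Inl q = 0" for q
    using zero[of "Inr q"] unfolding Inr by simp
  ultimately show "p = 0"
    unfolding vec_eq_iff by (metis sum.exhaust zero_index)
qed simp

theorem proposition3p3:
  fixes \<psi> :: "real \<Rightarrow> real"
    and V :: "real ^ 'd::finite \<Rightarrow> real"
    and C :: "('n::finite, 'd) state \<Rightarrow> real"
  assumes "CARD('n) \<ge> 2"
    and "standing_assumptions TYPE('n) \<psi> V"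
    and "has_partials C"
  shows "casimir (particle_system \<psi> V) C \<longleftrightarrow> (\<exists>\<gamma>. \<forall>r v. C (r, v) = \<gamma>)"
proof -
  \<comment> \<open>The block computation applies at each state separately, with D =
    \<open>Psi \<psi> z\<close>.\<close>
  have "casimir (particle_system \<psi> V) C \<longleftrightarrow> (\<forall>z. partial_z C z = 0)"
    using assms(3)
    by (simp add: casimir_def particle_system_def vector_matrix_mult_block_eq_0_iff)
  also have "\<dots> \<longleftrightarrow> (\<exists>\<gamma>. \<forall>z. C z = \<gamma>)"
    using constant_iff_partials_zero[OF assms(3)] by (simp add: partial_z_eq_0_iff)
  finally show ?thesis
    by (simp add: split_paired_all)
qed

end
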